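(* Let $\mathcal{G}=(\mathcal{V},\mathcal{F},\mathcal{E})$ be a double-edge factor graph (without single edges) representing the factorization $g(\boldsymbol{s},\tilde{\boldsymbol{s}})=\prod_{a\in\mathcal{F}}f_a(\boldsymbol{s}_{\partial a},\tilde{\boldsymbol{s}}_{\partial a})$, and let $Z(\mathcal{G})=\sum_{\boldsymbol{s},\tilde{\boldsymbol{s}}}g(\boldsymbol{s},\tilde{\boldsymbol{s}})$ be its partition sum. Let $\{m_{j\to a},m_{a\to j}\}_{(j,a)\in\mathcal{E}}$ be a set of fixed-point messages with $Z_{j,a}(m_{j\to a},m_{a\to j})\neq0$ for all $(j,a)\in\mathcal{E}$. Then there is a function $\mathcal{K}:\mathfrak{L}(\mathcal{E})\to\mathbb{C}$ with $\mathcal{K}(\emptyset)=1$ such that $$Z(\mathcal{G})=Z_{\mathsf{induced}}\big(\{m_{j\to a},m_{a\to j}\}_{(j,a)\in\mathcal{E}}\big)\cdot\sum_{E\in\mathfrak{L}(\mathcal{E})}\mathcal{K}(E),$$ where $\mathfrak{L}(\mathcal{E})$ is the set of generalized loops of $\mathcal{G}$.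
   Context: A double-edge factor graph (DeFG) without single edges is a finite bipartite graph $\mathcal{G}=(\mathcal{V},\mathcal{F},\mathcal{E}\subseteq\mathcal{V}\times\mathcal{F})$ together with a finite set (alphabet) $\mathcal{S}_j$ for each $j\in\mathcal{V}$ and, for each $a\in\mathcal{F}$ with set of neighbors $\partial a\subseteq\mathcal{V}$, a function $f_a(\boldsymbol{s}_{\partial a},\tilde{\boldsymbol{s}}_{\partial a})\in\mathbb{C}$ of $\boldsymbol{s}_{\partial a},\tilde{\boldsymbol{s}}_{\partial a}\in\prod_{j\in\partial a}\mathcal{S}_j$ whose associated matrix (row index $\boldsymbol{s}_{\partial a}$, column index $\tilde{\boldsymbol{s}}_{\partial a}$) is positive semidefinite. $\partial j\subseteq\mathcal{F}$ is the set of neighbors of $j\in\mathcal{V}$. A set of fixed-point messages is a family of functions $m_{j\to a},m_{a\to j}:\mathcal{S}_j^2\to\mathbb{C}$, $(j,a)\in\mathcal{E}$, whose associated $\mathcal{S}_j\times\mathcal{S}_j$ matrices are positive semidefinite, such that for all $(j,a)\in\mathcal{E}$, as functions of $(s_j,\tilde s_j)$, $$m_{j\to a}(s_j,\tilde s_j)\propto\prod_{c\in\partial j\setminus a}m_{c\to j}(s_j,\tilde s_j),\qquad m_{a\to j}(s_j,\tilde s_j)\propto\sum_{\boldsymbol{s}_{\partial a\setminus j},\tilde{\boldsymbol{s}}_{\partial a\setminus j}}f_a(\boldsymbol{s}_{\partial a},\tilde{\boldsymbol{s}}_{\partial a})\prod_{k\in\partial a\setminus j}m_{k\to a}(s_k,\tilde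 s_k),$$ where $\propto$ means equality up to a positive constant factor. The induced partition sum is $$Z_{\mathsf{induced}}=\frac{\prod_{a\in\mathcal{F}}Z_a\cdot\prod_{j\in\mathcal{V}}Z_j}{\prod_{(j,a)\in\mathcal{E}}Z_{j,a}},$$ with $Z_a=\sum_{\boldsymbol{s}_{\partial a},\tilde{\boldsymbol{s}}_{\partial a}}f_a(\boldsymbol{s}_{\partial a},\tilde{\boldsymbol{s}}_{\partial a})\prod_{j\in\partial a}m_{j\to a}(s_j,\tilde s_j)$, $Z_j=\sum_{s_j,\tilde s_j}\prod_{a\in\partial j}m_{a\to j}(s_j,\tilde s_j)$, and $Z_{j,a}=\sum_{s_j,\tilde s_j}m_{j\to a}(s_j,\tilde s_j)\,m_{a\to j}(s_j,\tilde s_j)$. The set of generalized loops $\mathfrak{L}(\mathcal{E})$ is the set of all $E\subseteq\mathcal{E}$ such that no vertex of $\mathcal{V}\sqcup\mathcal{F}$ is incident with exactly one edge of $E$; in particular $\emptyset\in\mathfrak{L}(\mathcal{E})$. *)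

theory Defs
  imports "HOL-Analysis.Analysis"
begin

text \<open>
  The matrix has rows and columns indexed by a finite set \<open>I\<close>; \<open>\<real>\<^sub>\<ge>\<^sub>0\<close> is the set of complex
  numbers that are real and nonnegative.
\<close>

definition psd_on :: "'i set \<Rightarrow> ('i \<Rightarrow> 'i \<Rightarrow> complex) \<Rightarrow> bool" where
  "psd_on I M \<longleftrightarrow>
     (\<forall>s\<in>I. \<forall>t\<in>I. M t s = cnj (M s t)) \<and>
     (\<forall>x :: 'i \<Rightarrow> complex. (\<Sum>s\<in>I. \<Sum>t\<in>I. cnj (x s) * M s t * x t) \<in> \<real>\<^sub>\<ge>\<^sub>0)"

text \<open>
  Variable nodes and function nodes have different types, so the vertex set of the bipartite
  graph is the disjoint union of \<open>vars G\<close> and \<open>facs G\<close>. The alphabets may differ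
  from node to node, but are subsets of one type. The arguments \<open>s\<close>, \<open>s'\<close> of
  \<open>loc_fun G a s s'\<close> are elements of the extensional product of the alphabets over the
  neighbors of \<open>a\<close>; \<open>s'\<close> plays the role of the second copy (with tilde) of the variables.
\<close>

record ('v, 'f, 's) factor_graph =
  vars :: "'v set"
  facs :: "'f set"
  edges :: "('v \<times> 'f) set"
  alphabet :: "'v \<Rightarrow> 's set"
  loc_fun :: "'f \<Rightarrow> ('v \<Rightarrow> 's) \<Rightarrow> ('v \<Rightarrow> 's) \<Rightarrow> complex"

definition fac_nbrs :: "('v, 'f, 's) factor_graph \<Rightarrow> 'f \<Rightarrow> 'v set" where
  "fac_nbrs G a = {j. (j, a) \<in> edges G}"

definition var_nbrs :: "('v, 'f, 's) factor_graph \<Rightarrow> 'v \<Rightarrow> 'f set" where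
  "var_nbrs G j = {a. (j, a) \<in> edges G}"

definition configs :: "('v, 'f, 's) factor_graph \<Rightarrow> 'v set \<Rightarrow> ('v \<Rightarrow> 's) set" where
  "configs G J = (\<Pi>\<^sub>E j\<in>J. alphabet G j)"

definition defg :: "('v, 'f, 's) factor_graph \<Rightarrow> bool" where
  "defg G \<longleftrightarrow>
     finite (vars G) \<and> finite (facs G) \<and> edges G \<subseteq> vars G \<times> facs G \<and>
     (\<forall>j\<in>vars G. finite (alphabet G j)) \<and>
     (\<forall>a\<in>facs G. psd_on (configs G (fac_nbrs G a)) (loc_fun G a))"

definition global_fun ::
    "('v, 'f, 's) factor_graph \<Rightarrow> ('v \<Rightarrow> 's) \<Rightarrow> ('v \<Rightarrow> 's) \<Rightarrow> complex" where
  "global_fun G s s' =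
     (\<Prod>a\<in>facs G. loc_fun G a (restrict s (fac_nbrs G a)) (restrict s' (fac_nbrs G a)))"

definition partition_sum :: "('v, 'f, 's) factor_graph \<Rightarrow> complex" where
  "partition_sum G = (\<Sum>s\<in>configs G (vars G). \<Sum>s'\<in>configs G (vars G). global_fun G s s')"

definition pos_proportional_on ::
    "'s set \<Rightarrow> ('s \<Rightarrow> 's \<Rightarrow> complex) \<Rightarrow> ('s \<Rightarrow> 's \<Rightarrow> complex) \<Rightarrow> bool" where
  "pos_proportional_on A p q \<longleftrightarrow>
     (\<exists>c::real. c > 0 \<and> (\<forall>s\<in>A. \<forall>s'\<in>A. p s s' = complex_of_real c * q s s'))"

text \<open>
  Messages: \<open>mv j a\<close> is the message from the variable node \<open>j\<close> to the function node \<open>a\<close>,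
  and \<open>mf a j\<close> the message from \<open>a\<close> to \<open>j\<close>. In the second update rule the sum ranges over
  the variables in \<open>fac_nbrs G a - {j}\<close>, and the value at \<open>j\<close> is filled in by the function
  update.
\<close>

type_synonym ('v, 'f, 's) var_msgs = "'v \<Rightarrow> 'f \<Rightarrow> 's \<Rightarrow> 's \<Rightarrow> complex"
type_synonym ('v, 'f, 's) fac_msgs = "'f \<Rightarrow> 'v \<Rightarrow> 's \<Rightarrow> 's \<Rightarrow> complex"

definition fixed_point_messages ::
    "('v, 'f, 's) factor_graph \<Rightarrow> ('v, 'f, 's) var_msgs \<Rightarrow> ('v, 'f, 's) fac_msgs \<Rightarrow> bool" where
  "fixed_point_messages G mv mf \<longleftrightarrow>
     (\<forall>(j, a)\<in>edges G.
        psd_on (alphabet G j) (mv j a) \<and>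
        psd_on (alphabet G j) (mf a j) \<and>
        pos_proportional_on (alphabet G j) (mv j a)
          (\<lambda>s s'. \<Prod>c\<in>var_nbrs G j - {a}. mf c j s s') \<and>
        pos_proportional_on (alphabet G j) (mf a j)
          (\<lambda>s s'. \<Sum>x\<in>configs G (fac_nbrs G a - {j}). \<Sum>x'\<in>configs G (fac_nbrs G a - {j}).
             loc_fun G a (x(j := s)) (x'(j := s')) *
             (\<Prod>k\<in>fac_nbrs G a - {j}. mv k a (x k) (x' k))))"

definition Z_fac ::
    "('v, 'f, 's) factor_graph \<Rightarrow> ('v, 'f, 's) var_msgs \<Rightarrow> 'f \<Rightarrow> complex" where
  "Z_fac G mv a =
     (\<Sum>x\<in>configs G (fac_nbrs G a). \<Sum>x'\<in>configs G (fac_nbrs G a).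
        loc_fun G a x x' * (\<Prod>j\<in>fac_nbrs G a. mv j a (x j) (x' j)))"

definition Z_var ::
    "('v, 'f, 's) factor_graph \<Rightarrow> ('v, 'f, 's) fac_msgs \<Rightarrow> 'v \<Rightarrow> complex" where
  "Z_var G mf j = (\<Sum>s\<in>alphabet G j. \<Sum>s'\<in>alphabet G j. \<Prod>a\<in>var_nbrs G j. mf a j s s')"

definition Z_edge ::
    "('v, 'f, 's) factor_graph \<Rightarrow> ('v, 'f, 's) var_msgs \<Rightarrow> ('v, 'f, 's) fac_msgs \<Rightarrow>
     'v \<Rightarrow> 'f \<Rightarrow> complex" where
  "Z_edge G mv mf j a = (\<Sum>s\<in>alphabet G j. \<Sum>s'\<in>alphabet G j. mv j a s s' * mf a j s s')"

definition Z_induced ::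
    "('v, 'f, 's) factor_graph \<Rightarrow> ('v, 'f, 's) var_msgs \<Rightarrow> ('v, 'f, 's) fac_msgs \<Rightarrow> complex" where
  "Z_induced G mv mf =
     (\<Prod>a\<in>facs G. Z_fac G mv a) * (\<Prod>j\<in>vars G. Z_var G mf j) /
     (\<Prod>(j, a)\<in>edges G. Z_edge G mv mf j a)"

definition generalized_loops :: "('v, 'f, 's) factor_graph \<Rightarrow> ('v \<times> 'f) set set" where
  "generalized_loops G =
     {L. L \<subseteq> edges G \<and>
         (\<forall>j\<in>vars G. card {e \<in> L. fst e = j} \<noteq> 1) \<and>
         (\<forall>a\<in>facs G. card {e \<in> L. snd e = a} \<noteq> 1)}"

end

theory Submission
  imports Defs
begin

text \<open>
  Give every edge \<open>(j, a)\<close> its own copy of the variable at \<open>j\<close>, tied to the original by a Kronecker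
  delta, and write the delta as \<open>P + Q\<close>, where
  \<open>P x t = m\<^bsub>j\<rightarrow>a\<^esub> x * m\<^bsub>a\<rightarrow>j\<^esub> t / Z\<^bsub>j,a\<^esub>\<close> has rank one. Expanding the product over all edges
  gives a sum over edge sets \<open>L\<close>, with \<open>Q\<close> on \<open>L\<close> and \<open>P\<close> elsewhere. The term \<open>L = {}\<close> factorizes
  into the induced partition sum. If some vertex meets exactly one edge of \<open>L\<close>, the fixed-point
  equation at that vertex turns its local sum into a message contracted with \<open>Q\<close>, which is zero.
  Finally, if the induced partition sum is zero, then the vanishing factor belongs to an isolated
  vertex, and this factor also divides the partition sum.
\<close>

section \<open>Sums over extensional products\<close>

lemma sum_PiE_insert:
  assumes "i \<notin> I"
  shows "sum g (PiE (insert i I) B) = (\<Sum>y\<in>B i. \<Sum>x\<in>PiE I B. g (x(i := y)))"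
  using assms
  by (simp add: PiE_insert_eq sum.reindex inj_combinator sum.cartesian_product)
     (simp add: case_prod_unfold)

text \<open>Pairs of configurations correspond bijectively to configurations of pairs. This is what
  lets the two copies of the variables in a double-edge graph be merged into one variable with a
  product alphabet.\<close>

lemma sum_PiE_Times:
  "(\<Sum>x\<in>PiE I B. \<Sum>x'\<in>PiE I C. g x x') =
     (\<Sum>y\<in>PiE I (\<lambda>i. B i \<times> C i). g (\<lambda>i\<in>I. fst (y i)) (\<lambda>i\<in>I. snd (y i)))"
proof -
  have "(\<Sum>x\<in>PiE I B. \<Sum>x'\<in>PiE I C. g x x') = (\<Sum>(x, x')\<in>PiE I B \<times> PiE I C. g x x')"
    by (rule sum.cartesian_product)
  also have "\<dots> = (\<Sum>y\<in>PiE I (\<lambda>i. B i \<times> C i). g (\<lambda>i\<in>I. fst (y i)) (\<lambda>i\<in>I. snd (y i)))"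
  proof (rule sum.reindex_bij_witness
      [of _ "\<lambda>y. (\<lambda>i\<in>I. fst (y i), \<lambda>i\<in>I. snd (y i))" "\<lambda>(x, x'). \<lambda>i\<in>I. (x i, x' i)"])
    fix y
    assume y: "y \<in> PiE I (\<lambda>i. B i \<times> C i)"
    show "(\<lambda>i\<in>I. fst (y i), \<lambda>i\<in>I. snd (y i)) \<in> PiE I B \<times> PiE I C"
      using y by (auto simp: restrict_PiE_iff PiE_iff mem_Times_iff)
    have "(\<lambda>i\<in>I. (fst (y i), snd (y i))) = y"
      using y by simp
    then show "(case (\<lambda>i\<in>I. fst (y i), \<lambda>i\<in>I. snd (y i)) of (x, x') \<Rightarrow> \<lambda>i\<in>I. (x i, x' i)) = y"
      by (simp cong: restrict_cong)
  qed (auto simp: restrict_PiE_iff PiE_iff extensional_restrict cong: restrict_cong)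
  finally show ?thesis .
qed

section \<open>Ordinary factor graphs with fixed-point messages\<close>

text \<open>Here a value \<open>t\<close> stands for a whole pair of values on a double edge, so
  every edge is single. Of the proportionality in the update rules only a nonzero constant is
  kept.\<close>

locale belief_propagation =
  fixes V :: "'v set" and F :: "'f set" and E :: "('v \<times> 'f) set"
    and A :: "'v \<Rightarrow> 't set"
    and f :: "'f \<Rightarrow> ('v \<Rightarrow> 't) \<Rightarrow> 'c::field_char_0"
    and mv :: "'v \<Rightarrow> 'f \<Rightarrow> 't \<Rightarrow> 'c"
    and mf :: "'f \<Rightarrow> 'v \<Rightarrow> 't \<Rightarrow> 'c"
    and nF :: "'f \<Rightarrow> 'v set" and nV :: "'v \<Rightarrow> 'f set"
    and Ze :: "'v \<Rightarrow> 'f \<Rightarrow> 'c"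
  defines "nF a \<equiv> {j. (j, a) \<in> E}" and "nV j \<equiv> {a. (j, a) \<in> E}"
    and "Ze j a \<equiv> \<Sum>t\<in>A j. mv j a t * mf a j t"
  assumes finite_V: "finite V" and finite_F: "finite F" and E_subset: "E \<subseteq> V \<times> F"
    and finite_A: "j \<in> V \<Longrightarrow> finite (A j)"
    and mv_fixed: "(j, a) \<in> E \<Longrightarrow>
      \<exists>c. c \<noteq> 0 \<and> (\<forall>t\<in>A j. mv j a t = c * (\<Prod>b\<in>nV j - {a}. mf b j t))"
    and mf_fixed: "(j, a) \<in> E \<Longrightarrow>
      \<exists>c. c \<noteq> 0 \<and> (\<forall>t\<in>A j. mf a j t =
        c * (\<Sum>x\<in>PiE (nF a - {j}) A. f a (x(j := t)) * (\<Prod>k\<in>nF a - {j}. mv k a (x k))))"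
    and Ze_nonzero: "(j, a) \<in> E \<Longrightarrow> Ze j a \<noteq> 0"
begin

text \<open>This is the matrix \<open>P\<close> of the introduction: \<open>x\<close> is the copy
  held by \<open>a\<close>, and \<open>t\<close> the original value at \<open>j\<close>. Division by
  \<open>Ze j a\<close> makes \<open>P\<close> idempotent, so \<open>excess\<close> is the
  complementary projection \<open>Q\<close>.\<close>

definition cut :: "'v \<Rightarrow> 'f \<Rightarrow> 't \<Rightarrow> 't \<Rightarrow> 'c" where
  "cut j a x t = mv j a x * mf a j t / Ze j a"

definition excess :: "'v \<Rightarrow> 'f \<Rightarrow> 't \<Rightarrow> 't \<Rightarrow> 'c" where
  "excess j a x t = (if x = t then 1 else 0) - cut j a x t"

definition kernel :: "('v \<times> 'f) set \<Rightarrow> 'v \<Rightarrow> 'f \<Rightarrow> 't \<Rightarrow> 't \<Rightarrow> 'c" where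
  "kernel L j a = (if (j, a) \<in> L then excess j a else cut j a)"

text \<open>The partition sum after splitting: each function node \<open>a\<close> reads its own
  copies \<open>w a\<close>, and \<open>R\<close> couples them to the originals \<open>s\<close>.
  Leaving \<open>R\<close> open covers the delta, \<open>cut\<close> and every
  \<open>kernel L\<close> at once.\<close>

definition edge_sum :: "('v \<Rightarrow> 'f \<Rightarrow> 't \<Rightarrow> 't \<Rightarrow> 'c) \<Rightarrow> 'c" where
  "edge_sum R = (\<Sum>s\<in>PiE V A. \<Sum>w\<in>PiE F (\<lambda>a. PiE (nF a) A).
     (\<Prod>a\<in>F. f a (w a)) * (\<Prod>(j, a)\<in>E. R j a (w a j) (s j)))"

definition Z :: 'c where
  "Z = (\<Sum>s\<in>PiE V A. \<Prod>a\<in>F. f a (restrict s (nF a)))"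

definition Zf :: "'f \<Rightarrow> 'c" where
  "Zf a = (\<Sum>x\<in>PiE (nF a) A. f a x * (\<Prod>j\<in>nF a. mv j a (x j)))"

definition Zv :: "'v \<Rightarrow> 'c" where
  "Zv j = (\<Sum>t\<in>A j. \<Prod>a\<in>nV j. mf a j t)"

lemma finite_E: "finite E"
  using E_subset finite_V finite_F by (meson finite_SigmaI finite_subset)

lemma nF_subset: "nF a \<subseteq> V" and nV_subset: "nV j \<subseteq> F"
  using E_subset by (auto simp: nF_def nV_def)

lemma finite_nF: "finite (nF a)" and finite_nV: "finite (nV j)"
  using finite_subset[OF nF_subset finite_V] finite_subset[OF nV_subset finite_F] by auto

lemma finite_configs: "finite (PiE (nF a) A)"
  using nF_subset by (intro finite_PiE finite_nF finite_A) auto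

lemma mem_nF [simp]: "j \<in> nF a \<longleftrightarrow> (j, a) \<in> E" and mem_nV [simp]: "a \<in> nV j \<longleftrightarrow> (j, a) \<in> E"
  by (auto simp: nF_def nV_def)

lemma prod_E_by_fac: "(\<Prod>(j, a)\<in>E. g j a) = (\<Prod>a\<in>F. \<Prod>j\<in>nF a. g j a)"
proof -
  have "(\<Prod>a\<in>F. \<Prod>j\<in>nF a. g j a) = (\<Prod>(a, j)\<in>Sigma F nF. g j a)"
    using finite_F finite_nF by (simp add: prod.Sigma)
  also have "\<dots> = (\<Prod>(j, a)\<in>E. g j a)"
    using E_subset by (intro prod.reindex_bij_witness[of _ prod.swap prod.swap]) auto
  finally show ?thesis by simp
qed

lemma prod_E_by_var: "(\<Prod>(j, a)\<in>E. g j a) = (\<Prod>j\<in>V. \<Prod>a\<in>nV j. g j a)"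
proof -
  have "(\<Prod>j\<in>V. \<Prod>a\<in>nV j. g j a) = (\<Prod>(j, a)\<in>Sigma V nV. g j a)"
    using finite_V finite_nV by (simp add: prod.Sigma)
  also have "Sigma V nV = E"
    using E_subset by auto
  finally show ?thesis by simp
qed

section \<open>Factorization and expansion of the split partition sum\<close>

text \<open>For fixed \<open>s\<close>, the copies at different function nodes are independent. In
  \<open>edge_sum_by_var\<close> the roles are exchanged: for fixed \<open>w\<close>, the originals
  are independent.\<close>

lemma edge_sum_by_fac:
  "edge_sum R = (\<Sum>s\<in>PiE V A. \<Prod>a\<in>F. \<Sum>x\<in>PiE (nF a) A. f a x * (\<Prod>j\<in>nF a. R j a (x j) (s j)))"
  unfolding edge_sum_def prod_E_by_fac prod.distrib[symmetric]
  using finite_F finite_configs by (subst prod_sum_PiE) auto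

lemma edge_sum_by_var:
  "edge_sum R = (\<Sum>w\<in>PiE F (\<lambda>a. PiE (nF a) A). (\<Prod>a\<in>F. f a (w a)) *
     (\<Prod>j\<in>V. \<Sum>t\<in>A j. \<Prod>a\<in>nV j. R j a (w a j) t))"
  unfolding edge_sum_def prod_E_by_var
  using finite_V finite_A
  by (subst sum.swap) (simp add: prod_sum_PiE sum_distrib_left)

text \<open>The deltas around \<open>a\<close> leave only the copy
  \<open>x = restrict s (nF a)\<close>.\<close>

lemma edge_sum_delta: "edge_sum (\<lambda>j a x t. if x = t then 1 else 0) = Z"
  unfolding edge_sum_by_fac Z_def
proof (intro sum.cong prod.cong refl)
  fix s a
  assume s: "s \<in> PiE V A"
  let ?r = "restrict s (nF a)"
  have r: "?r \<in> PiE (nF a) A"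
    using s nF_subset by (auto simp: PiE_iff)
  have "(\<Prod>j\<in>nF a. if x j = s j then 1 else 0) = (if x = ?r then 1 else (0::'c))"
    if x: "x \<in> PiE (nF a) A" for x
  proof (cases "x = ?r")
    case False
    then obtain j where "j \<in> nF a" "x j \<noteq> s j"
      using PiE_ext[OF x r] False by auto
    then have "(\<Prod>j\<in>nF a. if x j = s j then 1 else (0::'c)) = 0"
      using finite_nF by (intro prod_zero) auto
    then show ?thesis using False by simp
  qed simp
  then have "(\<Sum>x\<in>PiE (nF a) A. f a x * (\<Prod>j\<in>nF a. if x j = s j then 1 else 0)) =
      (\<Sum>x\<in>PiE (nF a) A. if x = ?r then f a x else 0)"
    by (intro sum.cong) auto
  also have "\<dots> = f a ?r"
    using r finite_configs by simp
  finally show "(\<Sum>x\<in>PiE (nF a) A. f a x * (\<Prod>j\<in>nF a. if x j = s j then 1 else 0)) = f a ?r" .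
qed

lemma Z_expansion: "Z = (\<Sum>L\<in>Pow E. edge_sum (kernel L))"
proof -
  have expand: "(\<Prod>(j, a)\<in>E. if w a j = s j then 1 else 0) =
      (\<Sum>L\<in>Pow E. \<Prod>(j, a)\<in>E. kernel L j a (w a j) (s j))" for w s
  proof -
    let ?q = "\<lambda>(j, a). excess j a (w a j) (s j)" and ?p = "\<lambda>(j, a). cut j a (w a j) (s j)"
    have "(\<Prod>(j, a)\<in>E. if w a j = s j then 1 else 0) = (\<Prod>e\<in>E. ?q e + ?p e)"
      by (intro prod.cong) (auto simp: excess_def)
    also have "\<dots> = (\<Sum>L\<in>Pow E. prod ?q L * prod ?p (E - L))"
      by (rule prod_add[OF finite_E])
    also have "\<dots> = (\<Sum>L\<in>Pow E. \<Prod>(j, a)\<in>E. kernel L j a (w a j) (s j))"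
    proof (rule sum.cong)
      fix L assume "L \<in> Pow E"
      then have "(\<Prod>(j, a)\<in>E. kernel L j a (w a j) (s j)) =
          (\<Prod>(j, a)\<in>E - L. kernel L j a (w a j) (s j)) * (\<Prod>(j, a)\<in>L. kernel L j a (w a j) (s j))"
        by (intro prod.subset_diff finite_E) auto
      also have "(\<Prod>(j, a)\<in>E - L. kernel L j a (w a j) (s j)) = prod ?p (E - L)"
        by (intro prod.cong) (auto simp: kernel_def)
      also have "(\<Prod>(j, a)\<in>L. kernel L j a (w a j) (s j)) = prod ?q L"
        by (intro prod.cong) (auto simp: kernel_def)
      finally show "prod ?q L * prod ?p (E - L) = (\<Prod>(j, a)\<in>E. kernel L j a (w a j) (s j))"
        by (simp add: mult.commute)
    qed simp
    finally show ?thesis .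
  qed
  have "Z = (\<Sum>s\<in>PiE V A. \<Sum>w\<in>PiE F (\<lambda>a. PiE (nF a) A). \<Sum>L\<in>Pow E.
      (\<Prod>a\<in>F. f a (w a)) * (\<Prod>(j, a)\<in>E. kernel L j a (w a j) (s j)))"
    by (simp add: edge_sum_delta[symmetric] edge_sum_def expand sum_distrib_left)
  also have "\<dots> = (\<Sum>s\<in>PiE V A. \<Sum>L\<in>Pow E. \<Sum>w\<in>PiE F (\<lambda>a. PiE (nF a) A).
      (\<Prod>a\<in>F. f a (w a)) * (\<Prod>(j, a)\<in>E. kernel L j a (w a j) (s j)))"
    by (intro sum.cong refl sum.swap)
  also have "\<dots> = (\<Sum>L\<in>Pow E. edge_sum (kernel L))"
    unfolding edge_sum_def by (rule sum.swap)
  finally show ?thesis .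
qed

text \<open>Having rank one, \<open>cut\<close> is a function of the copy times a function of the
  original, so the sums over \<open>w\<close> and \<open>s\<close> separate. The factors
  \<open>mv\<close> go to the function nodes, the factors \<open>mf\<close> to the variable
  nodes.\<close>

lemma edge_sum_cut:
  "edge_sum cut = (\<Prod>a\<in>F. Zf a) * (\<Prod>j\<in>V. Zv j) / (\<Prod>(j, a)\<in>E. Ze j a)"
proof -
  let ?W = "PiE F (\<lambda>a. PiE (nF a) A)"
  have "(\<Prod>a\<in>F. f a (w a)) * (\<Prod>(j, a)\<in>E. cut j a (w a j) (s j)) =
      (\<Prod>a\<in>F. f a (w a) * (\<Prod>j\<in>nF a. mv j a (w a j))) *
      (\<Prod>j\<in>V. \<Prod>a\<in>nV j. mf a j (s j)) / (\<Prod>(j, a)\<in>E. Ze j a)" for w s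
  proof -
    have "(\<Prod>(j, a)\<in>E. cut j a (w a j) (s j)) =
        (\<Prod>(j, a)\<in>E. mv j a (w a j)) * (\<Prod>(j, a)\<in>E. mf a j (s j)) / (\<Prod>(j, a)\<in>E. Ze j a)"
      by (simp add: cut_def case_prod_unfold prod.distrib prod_dividef)
    also have "(\<Prod>(j, a)\<in>E. mv j a (w a j)) = (\<Prod>a\<in>F. \<Prod>j\<in>nF a. mv j a (w a j))"
      by (rule prod_E_by_fac)
    also have "(\<Prod>(j, a)\<in>E. mf a j (s j)) = (\<Prod>j\<in>V. \<Prod>a\<in>nV j. mf a j (s j))"
      by (rule prod_E_by_var)
    finally show ?thesis
      by (simp add: prod.distrib mult.assoc)
  qed
  then have "edge_sum cut = (\<Sum>s\<in>PiE V A. \<Sum>w\<in>?W.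
      (\<Prod>a\<in>F. f a (w a) * (\<Prod>j\<in>nF a. mv j a (w a j))) *
      (\<Prod>j\<in>V. \<Prod>a\<in>nV j. mf a j (s j)) / (\<Prod>(j, a)\<in>E. Ze j a))"
    by (simp only: edge_sum_def)
  also have "\<dots> = (\<Sum>w\<in>?W. \<Prod>a\<in>F. f a (w a) * (\<Prod>j\<in>nF a. mv j a (w a j))) *
      (\<Sum>s\<in>PiE V A. \<Prod>j\<in>V. \<Prod>a\<in>nV j. mf a j (s j)) / (\<Prod>(j, a)\<in>E. Ze j a)"
    by (subst sum.swap) (simp only: sum_product sum_divide_distrib)
  also have "(\<Sum>w\<in>?W. \<Prod>a\<in>F. f a (w a) * (\<Prod>j\<in>nF a. mv j a (w a j))) = (\<Prod>a\<in>F. Zf a)"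
    unfolding Zf_def by (rule prod_sum_PiE[symmetric]) (auto simp: finite_F finite_configs)
  also have "(\<Sum>s\<in>PiE V A. \<Prod>j\<in>V. \<Prod>a\<in>nV j. mf a j (s j)) = (\<Prod>j\<in>V. Zv j)"
    unfolding Zv_def by (rule prod_sum_PiE[symmetric]) (auto simp: finite_V finite_A)
  finally show ?thesis .
qed

section \<open>Vanishing at a vertex with a single edge in the edge set\<close>

text \<open>\<open>cut j a\<close> fixes the vector \<open>mv j a\<close>, so its complement
  annihilates it; \<open>mf_excess\<close> is the same from the left.\<close>

lemma excess_mv:
  assumes "(j, a) \<in> E" "x \<in> A j"
  shows "(\<Sum>t\<in>A j. excess j a x t * mv j a t) = 0"
proof -
  have fin: "finite (A j)"
    using assms E_subset finite_A by auto
  have "(\<Sum>t\<in>A j. excess j a x t * mv j a t) =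
      (\<Sum>t\<in>A j. if x = t then mv j a t else 0) - (\<Sum>t\<in>A j. cut j a x t * mv j a t)"
    unfolding sum_subtractf[symmetric] by (intro sum.cong) (auto simp: excess_def algebra_simps)
  also have "(\<Sum>t\<in>A j. cut j a x t * mv j a t) = mv j a x / Ze j a * (\<Sum>t\<in>A j. mv j a t * mf a j t)"
    by (simp add: cut_def sum_distrib_left mult_ac)
  also have "\<dots> = mv j a x"
    using Ze_nonzero[OF assms(1)] by (simp add: Ze_def)
  finally show ?thesis
    using fin assms by simp
qed

lemma mf_excess:
  assumes "(j, a) \<in> E" "t \<in> A j"
  shows "(\<Sum>x\<in>A j. mf a j x * excess j a x t) = 0"
proof -
  have fin: "finite (A j)"
    using assms E_subset finite_A by auto
  have "(\<Sum>x\<in>A j. mf a j x * excess j a x t) =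
      (\<Sum>x\<in>A j. if x = t then mf a j x else 0) - (\<Sum>x\<in>A j. mf a j x * cut j a x t)"
    unfolding sum_subtractf[symmetric] by (intro sum.cong) (auto simp: excess_def algebra_simps)
  also have "(\<Sum>x\<in>A j. mf a j x * cut j a x t) = mf a j t / Ze j a * (\<Sum>x\<in>A j. mv j a x * mf a j x)"
    by (simp add: cut_def sum_distrib_left mult_ac)
  also have "\<dots> = mf a j t"
    using Ze_nonzero[OF assms(1)] by (simp add: Ze_def)
  finally show ?thesis
    using fin assms by simp
qed

text \<open>All other edges at \<open>j\<close> carry \<open>cut\<close>, and their dependence on
  \<open>t\<close> is the product of the incoming messages \<open>mf b j t\<close>. By
  \<open>mv_fixed\<close> this is a multiple of \<open>mv j a t\<close>, which
  \<open>excess j a\<close> annihilates.\<close>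

lemma edge_sum_lone_var:
  assumes "(j, a) \<in> E" "(j, a) \<in> L" "\<And>b. (j, b) \<in> L \<Longrightarrow> b = a"
  shows "edge_sum (kernel L) = 0"
  unfolding edge_sum_by_var
proof (intro sum.neutral ballI)
  fix w
  assume w: "w \<in> PiE F (\<lambda>a. PiE (nF a) A)"
  have a: "j \<in> V" "a \<in> F"
    using assms(1) E_subset by auto
  have x: "w a j \<in> A j"
    using w a assms(1) by (auto simp: PiE_iff)
  obtain c where c: "c \<noteq> 0" "\<And>t. t \<in> A j \<Longrightarrow> mv j a t = c * (\<Prod>b\<in>nV j - {a}. mf b j t)"
    using mv_fixed[OF assms(1)] by blast
  \<comment> \<open>The part of the cuts at \<open>j\<close> that is constant in
    \<open>t\<close>.\<close>
  define d where "d = (\<Prod>b\<in>nV j - {a}. mv j b (w b j) / Ze j b)"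
  have "(\<Prod>b\<in>nV j. kernel L j b (w b j) t) = d / c * (excess j a (w a j) t * mv j a t)"
    if t: "t \<in> A j" for t
  proof -
    have "(\<Prod>b\<in>nV j. kernel L j b (w b j) t) =
        kernel L j a (w a j) t * (\<Prod>b\<in>nV j - {a}. kernel L j b (w b j) t)"
      using assms(1) finite_nV by (intro prod.remove) auto
    also have "(\<Prod>b\<in>nV j - {a}. kernel L j b (w b j) t) =
        (\<Prod>b\<in>nV j - {a}. mv j b (w b j) / Ze j b * mf b j t)"
      using assms(3) by (intro prod.cong) (auto simp: kernel_def cut_def)
    also have "\<dots> = d * (mv j a t / c)"
      unfolding d_def prod.distrib using c t by simp
    finally show ?thesis
      using assms(2) by (simp add: kernel_def mult_ac)
  qed
  then have "(\<Sum>t\<in>A j. \<Prod>b\<in>nV j. kernel L j b (w b j) t) =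
      d / c * (\<Sum>t\<in>A j. excess j a (w a j) t * mv j a t)"
    by (simp add: sum_distrib_left)
  then have "(\<Sum>t\<in>A j. \<Prod>b\<in>nV j. kernel L j b (w b j) t) = 0"
    using excess_mv[OF assms(1) x] by simp
  then have "(\<Prod>j\<in>V. \<Sum>t\<in>A j. \<Prod>b\<in>nV j. kernel L j b (w b j) t) = 0"
    using a finite_V by (intro prod_zero) auto
  then show "(\<Prod>a\<in>F. f a (w a)) * (\<Prod>j\<in>V. \<Sum>t\<in>A j. \<Prod>b\<in>nV j. kernel L j b (w b j) t) = 0"
    by simp
qed

lemma sum_configs_remove:
  assumes "(j, a) \<in> E"
  shows "(\<Sum>x\<in>PiE (nF a) A. f a x * (\<Prod>k\<in>nF a. g k (x k))) =
    (\<Sum>t\<in>A j. g j t * (\<Sum>x\<in>PiE (nF a - {j}) A. f a (x(j := t)) * (\<Prod>k\<in>nF a - {j}. g k (x k))))"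
proof -
  have *: "nF a = insert j (nF a - {j})"
    using assms by auto
  have "(\<Prod>k\<in>nF a. g k ((x(j := t)) k)) = g j t * (\<Prod>k\<in>nF a - {j}. g k (x k))" for x t
  proof -
    have "(\<Prod>k\<in>nF a. g k ((x(j := t)) k)) =
        g j ((x(j := t)) j) * (\<Prod>k\<in>nF a - {j}. g k ((x(j := t)) k))"
      using assms finite_nF by (intro prod.remove) auto
    also have "(\<Prod>k\<in>nF a - {j}. g k ((x(j := t)) k)) = (\<Prod>k\<in>nF a - {j}. g k (x k))"
      by (intro prod.cong) auto
    finally show ?thesis by simp
  qed
  then show ?thesis
    by (subst *, subst sum_PiE_insert) (simp_all add: insert_absorb assms sum_distrib_left mult_ac)
qed

text \<open>Dually, the cuts on the other edges at \<open>a\<close> supply the messages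
  \<open>mv k a (x k)\<close>. Summing over these copies gives the right-hand side of
  \<open>mf_fixed\<close>, hence a multiple of \<open>mf a j\<close>, which
  \<open>excess j a\<close> annihilates from the left.\<close>

lemma edge_sum_lone_fac:
  assumes "(j, a) \<in> E" "(j, a) \<in> L" "\<And>k. (k, a) \<in> L \<Longrightarrow> k = j"
  shows "edge_sum (kernel L) = 0"
  unfolding edge_sum_by_fac
proof (intro sum.neutral ballI)
  fix s
  assume s: "s \<in> PiE V A"
  have a: "j \<in> V" "a \<in> F"
    using assms(1) E_subset by auto
  have sj: "s j \<in> A j"
    using s a by auto
  let ?g = "\<lambda>t. \<Sum>x\<in>PiE (nF a - {j}) A. f a (x(j := t)) * (\<Prod>k\<in>nF a - {j}. mv k a (x k))"
  obtain c where c: "c \<noteq> 0" "\<And>t. t \<in> A j \<Longrightarrow> mf a j t = c * ?g t"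
    using mf_fixed[OF assms(1)] by blast
  \<comment> \<open>The part of the cuts at \<open>a\<close> that depends only on the fixed
    \<open>s\<close>.\<close>
  define d where "d = (\<Prod>k\<in>nF a - {j}. mf a k (s k) / Ze k a)"
  have cut: "(\<Prod>k\<in>nF a - {j}. kernel L k a (x k) (s k)) = (\<Prod>k\<in>nF a - {j}. mv k a (x k)) * d" for x
    unfolding d_def prod.distrib[symmetric]
    using assms(3) by (intro prod.cong) (auto simp: kernel_def cut_def)
  have "(\<Sum>x\<in>PiE (nF a) A. f a x * (\<Prod>k\<in>nF a. kernel L k a (x k) (s k))) =
      (\<Sum>t\<in>A j. kernel L j a t (s j) * (\<Sum>x\<in>PiE (nF a - {j}) A.
         f a (x(j := t)) * (\<Prod>k\<in>nF a - {j}. kernel L k a (x k) (s k))))"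
    by (rule sum_configs_remove[OF assms(1)])
  also have "\<dots> = (\<Sum>t\<in>A j. excess j a t (s j) * (?g t * d))"
    using assms(2) by (simp only: cut kernel_def[of L j a] if_True sum_distrib_right mult.assoc)
  also have "\<dots> = (\<Sum>t\<in>A j. d / c * (mf a j t * excess j a t (s j)))"
    using c by (intro sum.cong) auto
  also have "\<dots> = 0"
    unfolding sum_distrib_left[symmetric] using mf_excess[OF assms(1) sj] by simp
  finally show "(\<Prod>a\<in>F. \<Sum>x\<in>PiE (nF a) A. f a x * (\<Prod>k\<in>nF a. kernel L k a (x k) (s k))) = 0"
    using a finite_F by (intro prod_zero) auto
qed

section \<open>The case of a vanishing induced partition sum\<close>

text \<open>Substituting the update rule for \<open>mf a j\<close> into \<open>Ze j a\<close> yields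
  a nonzero multiple of \<open>Zf a\<close>. Likewise, the rule for \<open>mv j a\<close> yields
  \<open>Zv_nonzero\<close>. A zero factor can thus only sit at an isolated vertex.\<close>

lemma Zf_nonzero:
  assumes "(j, a) \<in> E"
  shows "Zf a \<noteq> 0"
proof
  assume "Zf a = 0"
  let ?g = "\<lambda>t. \<Sum>x\<in>PiE (nF a - {j}) A. f a (x(j := t)) * (\<Prod>k\<in>nF a - {j}. mv k a (x k))"
  obtain c where c: "c \<noteq> 0" "\<And>t. t \<in> A j \<Longrightarrow> mf a j t = c * ?g t"
    using mf_fixed[OF assms] by blast
  have "Ze j a = (\<Sum>t\<in>A j. c * (mv j a t * ?g t))"
    unfolding Ze_def using c by (intro sum.cong) auto
  also have "\<dots> = c * Zf a"
    by (simp add: Zf_def sum_configs_remove[OF assms, of "\<lambda>k. mv k a"] flip: sum_distrib_left)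
  finally show False
    using \<open>Zf a = 0\<close> Ze_nonzero[OF assms] by simp
qed

lemma Zv_nonzero:
  assumes "(j, a) \<in> E"
  shows "Zv j \<noteq> 0"
proof
  assume "Zv j = 0"
  obtain c where c: "c \<noteq> 0" "\<And>t. t \<in> A j \<Longrightarrow> mv j a t = c * (\<Prod>b\<in>nV j - {a}. mf b j t)"
    using mv_fixed[OF assms] by blast
  have "(\<Prod>b\<in>nV j. mf b j t) = mf a j t * (\<Prod>b\<in>nV j - {a}. mf b j t)" for t
    using assms finite_nV by (intro prod.remove) auto
  then have "Ze j a = (\<Sum>t\<in>A j. c * (\<Prod>b\<in>nV j. mf b j t))"
    unfolding Ze_def using c by (intro sum.cong) auto
  also have "\<dots> = c * Zv j"
    by (simp add: Zv_def sum_distrib_left)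
  finally show False
    using \<open>Zv j = 0\<close> Ze_nonzero[OF assms] by simp
qed

lemma Z_eq_0:
  assumes "edge_sum cut = 0"
  shows "Z = 0"
proof -
  have "(\<Prod>(j, a)\<in>E. Ze j a) \<noteq> 0"
    using finite_E Ze_nonzero by (auto simp: prod_zero_iff)
  then consider a where "a \<in> F" "Zf a = 0" | j where "j \<in> V" "Zv j = 0"
    using assms finite_F finite_V by (auto simp: edge_sum_cut prod_zero_iff)
  then show ?thesis
  proof cases
    case (1 a)
    then have "nF a = {}"
      using Zf_nonzero by (auto simp: nF_def)
    \<comment> \<open>With no neighbors, \<open>Zf a\<close> is the single value of
      \<open>f a\<close> at the empty configuration, a factor of every term of
      \<open>Z\<close>.\<close>
    then have "f a (restrict s (nF a)) = 0" for s
      using 1 by (simp add: Zf_def restrict_def)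
    then have "(\<Prod>a\<in>F. f a (restrict s (nF a))) = 0" for s
      using 1 finite_F by (intro prod_zero) auto
    then show ?thesis
      by (simp add: Z_def)
  next
    case (2 j)
    then have "nV j = {}"
      using Zv_nonzero by (auto simp: nV_def)
    \<comment> \<open>With no neighbors, \<open>Zv j\<close> sums empty products, so it is the
      cardinality of \<open>A j\<close> in the field; characteristic zero forces that cardinality to
      be zero.\<close>
    then have "A j = {}"
      using 2 finite_A[of j] by (simp add: Zv_def)
    then have "PiE V A = {}"
      using 2 by (auto simp: PiE_eq_empty_iff)
    then show ?thesis
      by (simp add: Z_def)
  qed
qed

section \<open>Restriction to generalized loops\<close>

lemma edge_sum_degree_1:
  assumes "L \<subseteq> E" "card {e \<in> L. fst e = j} = 1 \<or> card {e \<in> L. snd e = a} = 1"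
  shows "edge_sum (kernel L) = 0"
  using assms(2)
proof
  assume "card {e \<in> L. fst e = j} = 1"
  then obtain e where "{e \<in> L. fst e = j} = {e}"
    by (auto simp: card_1_singleton_iff)
  then have e: "e' \<in> L \<and> fst e' = j \<longleftrightarrow> e' = e" for e'
    by blast
  obtain b where b: "e = (j, b)"
    using e[of e] by (cases e) auto
  show ?thesis
    using assms(1) e[of "(j, _)"] by (intro edge_sum_lone_var[of j b]) (auto simp: b)
next
  assume "card {e \<in> L. snd e = a} = 1"
  then obtain e where "{e \<in> L. snd e = a} = {e}"
    by (auto simp: card_1_singleton_iff)
  then have e: "e' \<in> L \<and> snd e' = a \<longleftrightarrow> e' = e" for e'
    by blast
  obtain k where k: "e = (k, a)"
    using e[of e] by (cases e) auto
  show ?thesis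
    using assms(1) e[of "(_, a)"] by (intro edge_sum_lone_fac[of k a]) (auto simp: k)
qed

theorem loop_expansion:
  defines "loops \<equiv> {L. L \<subseteq> E \<and> (\<forall>j\<in>V. card {e \<in> L. fst e = j} \<noteq> 1) \<and>
                         (\<forall>a\<in>F. card {e \<in> L. snd e = a} \<noteq> 1)}"
  shows "\<exists>K. K {} = 1 \<and>
    Z = (\<Prod>a\<in>F. Zf a) * (\<Prod>j\<in>V. Zv j) / (\<Prod>(j, a)\<in>E. Ze j a) * (\<Sum>L\<in>loops. K L)"
proof -
  \<comment> \<open>Each term is normalized by the term of the empty edge set. The explicit case
    keeps \<open>K {} = 1\<close> even if that term is zero.\<close>
  define K where "K L = (if L = {} then 1 else edge_sum (kernel L) / edge_sum cut)" for L
  have "Z = (\<Sum>L\<in>loops. edge_sum (kernel L))"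
    unfolding Z_expansion loops_def
    using finite_E edge_sum_degree_1 by (intro sum.mono_neutral_right) auto
  moreover have "kernel {} = cut"
    by (simp add: kernel_def fun_eq_iff)
  then have "edge_sum (kernel L) = edge_sum cut * K L" if "edge_sum cut \<noteq> 0" for L
    using that by (simp add: K_def)
  \<comment> \<open>If \<open>edge_sum cut = 0\<close>, the quotients in \<open>K\<close> are junk, but both sides vanish.\<close>
  ultimately have "Z = edge_sum cut * (\<Sum>L\<in>loops. K L)"
    using Z_eq_0 by (cases "edge_sum cut = 0") (simp_all add: sum_distrib_left)
  moreover have "K {} = 1"
    by (simp add: K_def)
  ultimately show ?thesis
    unfolding edge_sum_cut by blast
qed

end

section \<open>Transfer to double-edge factor graphs\<close>

theorem theorem2p21:
  fixes G :: "('v, 'f, 's) factor_graph"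
    and mv :: "('v, 'f, 's) var_msgs"
    and mf :: "('v, 'f, 's) fac_msgs"
  assumes "defg G"
    and "fixed_point_messages G mv mf"
    and "\<forall>(j, a)\<in>edges G. Z_edge G mv mf j a \<noteq> 0"
  shows "\<exists>K :: ('v \<times> 'f) set \<Rightarrow> complex.
           K {} = 1 \<and>
           partition_sum G = Z_induced G mv mf * (\<Sum>L\<in>generalized_loops G. K L)"
proof -
  let ?A = "\<lambda>j. alphabet G j \<times> alphabet G j"
  let ?nF = "\<lambda>a. {j. (j, a) \<in> edges G}" and ?nV = "\<lambda>j. {a. (j, a) \<in> edges G}"
  \<comment> \<open>The merged variable at \<open>j\<close> is a pair; \<open>f\<close> unpacks it.
    Restricting both components to the neighbors makes them extensional, as the arguments of
    \<open>loc_fun\<close> are.\<close>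
  define f where
    "f a y = loc_fun G a (\<lambda>j\<in>?nF a. fst (y j)) (\<lambda>j\<in>?nF a. snd (y j))" for a and y :: "'v \<Rightarrow> 's \<times> 's"
  define mv2 where "mv2 j a t = mv j a (fst t) (snd t)" for j a and t :: "'s \<times> 's"
  define mf2 where "mf2 a j t = mf a j (fst t) (snd t)" for a j and t :: "'s \<times> 's"
  have Ze: "(\<Sum>t\<in>?A j. mv2 j a t * mf2 a j t) = Z_edge G mv mf j a" for j a
    by (simp add: Z_edge_def mv2_def mf2_def sum.cartesian_product case_prod_unfold)
  interpret belief_propagation "vars G" "facs G" "edges G" ?A f mv2 mf2 ?nF ?nV
    "\<lambda>j a. \<Sum>t\<in>?A j. mv2 j a t * mf2 a j t"
  proof unfold_locales
    fix j a
    assume e: "(j, a) \<in> edges G"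
    show "\<exists>c. c \<noteq> 0 \<and> (\<forall>t\<in>?A j. mv2 j a t = c * (\<Prod>b\<in>?nV j - {a}. mf2 b j t))"
    proof -
      have "pos_proportional_on (alphabet G j) (mv j a) (\<lambda>s s'. \<Prod>c\<in>var_nbrs G j - {a}. mf c j s s')"
        using assms(2) e by (auto simp: fixed_point_messages_def)
      then obtain c :: real where "c > 0"
        "\<forall>s\<in>alphabet G j. \<forall>s'\<in>alphabet G j.
           mv j a s s' = of_real c * (\<Prod>c\<in>var_nbrs G j - {a}. mf c j s s')"
        unfolding pos_proportional_on_def by blast
      then show ?thesis
        by (intro exI[of _ "of_real c"]) (auto simp: mv2_def mf2_def var_nbrs_def)
    qed
    show "\<exists>c. c \<noteq> 0 \<and> (\<forall>t\<in>?A j. mf2 a j t =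
        c * (\<Sum>x\<in>PiE (?nF a - {j}) ?A. f a (x(j := t)) * (\<Prod>k\<in>?nF a - {j}. mv2 k a (x k))))"
    proof -
      \<comment> \<open>Updating the pair at \<open>j\<close> updates both components; since
        \<open>j\<close> is a neighbor of \<open>a\<close>, the restriction in \<open>f\<close>
        keeps the new value.\<close>
      have "f a (y(j := t)) = loc_fun G a ((\<lambda>k\<in>?nF a - {j}. fst (y k))(j := fst t))
          ((\<lambda>k\<in>?nF a - {j}. snd (y k))(j := snd t))" for y t
        unfolding f_def using e by (intro arg_cong2[of _ _ _ _ "loc_fun G a"]) auto
      then have *: "(\<Sum>x\<in>PiE (?nF a - {j}) (alphabet G). \<Sum>x'\<in>PiE (?nF a - {j}) (alphabet G).
            loc_fun G a (x(j := fst t)) (x'(j := snd t)) * (\<Prod>k\<in>?nF a - {j}. mv k a (x k) (x' k))) =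
          (\<Sum>x\<in>PiE (?nF a - {j}) ?A. f a (x(j := t)) * (\<Prod>k\<in>?nF a - {j}. mv2 k a (x k)))" for t
        unfolding sum_PiE_Times mv2_def
        by (intro sum.cong refl arg_cong2[of _ _ _ _ "(*)"] prod.cong) auto
      have "pos_proportional_on (alphabet G j) (mf a j)
          (\<lambda>s s'. \<Sum>x\<in>configs G (fac_nbrs G a - {j}). \<Sum>x'\<in>configs G (fac_nbrs G a - {j}).
             loc_fun G a (x(j := s)) (x'(j := s')) *
             (\<Prod>k\<in>fac_nbrs G a - {j}. mv k a (x k) (x' k)))"
        using assms(2) e by (auto simp: fixed_point_messages_def)
      then obtain c :: real where "c > 0"
        "\<forall>s\<in>alphabet G j. \<forall>s'\<in>alphabet G j. mf a j s s' = of_real c *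
          (\<Sum>x\<in>PiE (?nF a - {j}) (alphabet G). \<Sum>x'\<in>PiE (?nF a - {j}) (alphabet G).
             loc_fun G a (x(j := s)) (x'(j := s')) * (\<Prod>k\<in>?nF a - {j}. mv k a (x k) (x' k)))"
        unfolding pos_proportional_on_def configs_def fac_nbrs_def by blast
      then show ?thesis
        unfolding *[symmetric] mf2_def by (intro exI[of _ "of_real c"]) auto
    qed
    show "(\<Sum>t\<in>?A j. mv2 j a t * mf2 a j t) \<noteq> 0"
      using assms(3) e by (auto simp: Ze)
  qed (use assms(1) in \<open>auto simp: defg_def\<close>)
  have "Z = partition_sum G"
    unfolding Z_def partition_sum_def configs_def sum_PiE_Times
  proof (rule sum.cong)
    fix y assume "y \<in> PiE (vars G) ?A"
    show "(\<Prod>a\<in>facs G. f a (restrict y (?nF a))) =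
        global_fun G (\<lambda>j\<in>vars G. fst (y j)) (\<lambda>j\<in>vars G. snd (y j))"
      \<comment> \<open>Restricting to \<open>vars G\<close> and then to the neighbors of
        \<open>a\<close> is the same as restricting to the neighbors, by
        \<open>nF_subset\<close>.\<close>
      unfolding global_fun_def f_def fac_nbrs_def
      using nF_subset by (intro prod.cong arg_cong2[of _ _ _ _ "loc_fun G _"]) (auto simp: fun_eq_iff)
  qed simp
  moreover have "Zf a = Z_fac G mv a" for a
    unfolding Zf_def Z_fac_def configs_def sum_PiE_Times fac_nbrs_def
    by (intro sum.cong) (auto simp: f_def mv2_def)
  moreover have "Zv j = Z_var G mf j" for j
    by (simp add: Zv_def Z_var_def mf2_def var_nbrs_def sum.cartesian_product case_prod_unfold)
  ultimately show ?thesis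
    using loop_expansion by (simp add: Ze Z_induced_def generalized_loops_def)
qed

end
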